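(* Let $s,q\in\mathbb N$ and $\epsilon\in(0,1)$. Let $\xi$ be a detailing of a distribution $\mu$ over $\{0,1\}^n$ with respect to a finite set $A$, with weight distribution $\eta=\xi|_2$ and type distribution $\Lambda$. If $\xi$ is $\left(\frac{\epsilon}{3(s+1)},q\right)$-good and $n\ge\frac{6q^2(s+1)}{\epsilon}$, then $d_{TV}(\mathcal{D}_{sim}(\eta,\Lambda),\mathcal{D}^{s,q}_{test}(\mu))\le\epsilon$.
   Context: A detailing of $\mu$ with respect to a finite set $A$ is a distribution $\xi$ over $\{0,1\}^n\times A$ whose marginal on $\{0,1\}^n$ is $\mu$; its weight distribution is the marginal $\xi|_2$ on $A$, and for $a$ with $\xi|_2(a)>0$, $\xi|_1^{2:a}$ denotes the distribution of the first coordinate conditioned on the second being $a$. The type of index $i\in[n]$ is $t_i\in[0,1]^A$ with $t_i(a)=\Pr_{x\sim\xi|_1^{2:a}}[x_i=1]$ if $\xi|_2(a)>0$ and $t_i(a)=0$ otherwise; the type distribution $\Lambda$ is the distribution of $t_{\mathbf i}$ for $\mathbf i$ uniform in $[n]$. For a distribution $\nu$ over $\{0,1\}^n$, a $q$-tuple $(j_1,\dots,j_q)$ of distinct indices is $\epsilon$-independent with respect to $\nu$ if $d_{TV}(\nu|_{\{j_1,\dots,j_q\}},\prod_{\ell=1}^q\nu|_{j_\ell})\le\epsilon$ (projection vs. product of one-coordinate marginals); $\nu$ is $(\epsilon,q)$-good if at least a $1-\epsilon$ fraction of the $q$-tuples of distinct indices are $\epsilon$-independent w.r.t. $\nu$;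 the detailing $\xi$ is $(\epsilon,q)$-good if there is $J\subseteq A$ with $\xi|_2(J)\ge1-\epsilon$ such that $\xi|_1^{2:a}$ is $(\epsilon,q)$-good for every $a\in J$. $\mathcal{D}_{sim}(\eta,\Lambda)$ is the distribution on $\{0,1\}^{s\times q}$ of the matrix $M$ obtained by drawing $t_1,\dots,t_q\sim\Lambda$ and $a_1,\dots,a_s\sim\eta$ independently, and then each $M_{i,j}\sim\mathrm{Ber}(t_j(a_i))$ independently. $\mathcal{D}^{s,q}_{test}(\mu)$ is the distribution of the matrix $M_{i,k}=x^i_{j_k}$ where $x^1,\dots,x^s\sim\mu$ independently and $j_1,\dots,j_q$ are independent uniform elements of $[n]$. *)

theory Defs
  imports "HOL-Probability.Probability"
begin

text \<open>Vectors in {0,1}^n are represented as functions nat => bool that are False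
  outside [n] = {0..<n}. Matrices in {0,1}^{s x q} as functions on nat x nat,
  False outside {0..<s} x {0..<q}.\<close>

definition dTV :: "'b pmf \<Rightarrow> 'b pmf \<Rightarrow> real" where
  "dTV p r = (SUP S. \<bar>measure_pmf.prob p S - measure_pmf.prob r S\<bar>)"

definition cube :: "nat \<Rightarrow> (nat \<Rightarrow> bool) set" where
  "cube n = {x. \<forall>i\<ge>n. \<not> x i}"

definition is_detailing :: "nat \<Rightarrow> (nat \<Rightarrow> bool) pmf \<Rightarrow> 'a set \<Rightarrow> ((nat \<Rightarrow> bool) \<times> 'a) pmf \<Rightarrow> bool" where
  "is_detailing n \<mu> A \<xi> \<longleftrightarrow> finite A \<and> set_pmf \<mu> \<subseteq> cube n \<and>
     set_pmf \<xi> \<subseteq> cube n \<times> A \<and> map_pmf fst \<xi> = \<mu>"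

definition weight_dist :: "((nat \<Rightarrow> bool) \<times> 'a) pmf \<Rightarrow> 'a pmf" where
  "weight_dist \<xi> = map_pmf snd \<xi>"

text \<open>first coordinate conditioned on second = a (meaningful when the weight of a is positive)\<close>
definition cond_first :: "((nat \<Rightarrow> bool) \<times> 'a) pmf \<Rightarrow> 'a \<Rightarrow> (nat \<Rightarrow> bool) pmf" where
  "cond_first \<xi> a = map_pmf fst (cond_pmf \<xi> {z. snd z = a})"

definition type_of :: "((nat \<Rightarrow> bool) \<times> 'a) pmf \<Rightarrow> nat \<Rightarrow> 'a \<Rightarrow> real" where
  "type_of \<xi> i a = (if pmf (weight_dist \<xi>) a > 0
     then measure_pmf.prob (cond_first \<xi> a) {x. x i} else 0)"

definition type_dist :: "nat \<Rightarrow> ((nat \<Rightarrow> bool) \<times> 'a) pmf \<Rightarrow> ('a \<Rightarrow> real) pmf" where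
  "type_dist n \<xi> = map_pmf (type_of \<xi>) (pmf_of_set {..<n})"

definition proj_pmf :: "nat set \<Rightarrow> (nat \<Rightarrow> bool) pmf \<Rightarrow> (nat \<Rightarrow> bool) pmf" where
  "proj_pmf J \<nu> = map_pmf (\<lambda>x i. if i \<in> J then x i else False) \<nu>"

definition prod_marginals :: "nat set \<Rightarrow> (nat \<Rightarrow> bool) pmf \<Rightarrow> (nat \<Rightarrow> bool) pmf" where
  "prod_marginals J \<nu> = Pi_pmf J False (\<lambda>j. map_pmf (\<lambda>x. x j) \<nu>)"

definition eps_independent :: "real \<Rightarrow> (nat \<Rightarrow> bool) pmf \<Rightarrow> nat list \<Rightarrow> bool" where
  "eps_independent \<epsilon> \<nu> js \<longleftrightarrow> dTV (proj_pmf (set js) \<nu>) (prod_marginals (set js) \<nu>) \<le> \<epsilon>"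

definition tuples :: "nat \<Rightarrow> nat \<Rightarrow> nat list set" where
  "tuples n q = {js. length js = q \<and> distinct js \<and> set js \<subseteq> {..<n}}"

definition good_dist :: "nat \<Rightarrow> real \<Rightarrow> nat \<Rightarrow> (nat \<Rightarrow> bool) pmf \<Rightarrow> bool" where
  "good_dist n \<epsilon> q \<nu> \<longleftrightarrow>
     real (card {js \<in> tuples n q. eps_independent \<epsilon> \<nu> js}) \<ge> (1 - \<epsilon>) * real (card (tuples n q))"

definition good_detailing :: "nat \<Rightarrow> real \<Rightarrow> nat \<Rightarrow> 'a set \<Rightarrow> ((nat \<Rightarrow> bool) \<times> 'a) pmf \<Rightarrow> bool" where
  "good_detailing n \<epsilon> q A \<xi> \<longleftrightarrow>
     (\<exists>J \<subseteq> A. measure_pmf.prob (weight_dist \<xi>) J \<ge> 1 - \<epsilon> \<and>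
        (\<forall>a\<in>J. pmf (weight_dist \<xi>) a > 0 \<and> good_dist n \<epsilon> q (cond_first \<xi> a)))"

definition D_sim :: "nat \<Rightarrow> nat \<Rightarrow> 'a pmf \<Rightarrow> ('a \<Rightarrow> real) pmf \<Rightarrow> (nat \<times> nat \<Rightarrow> bool) pmf" where
  "D_sim s q \<eta> \<Lambda> =
     bind_pmf (Pi_pmf {..<q} (\<lambda>_. 0) (\<lambda>_. \<Lambda>)) (\<lambda>t.
     bind_pmf (Pi_pmf {..<s} undefined (\<lambda>_. \<eta>)) (\<lambda>a.
       Pi_pmf ({..<s} \<times> {..<q}) False (\<lambda>(i, j). bernoulli_pmf (t j (a i)))))"

definition D_test :: "nat \<Rightarrow> nat \<Rightarrow> nat \<Rightarrow> (nat \<Rightarrow> bool) pmf \<Rightarrow> (nat \<times> nat \<Rightarrow> bool) pmf" where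
  "D_test n s q \<mu> =
     bind_pmf (Pi_pmf {..<s} (\<lambda>_. False) (\<lambda>_. \<mu>)) (\<lambda>x.
     bind_pmf (Pi_pmf {..<q} 0 (\<lambda>_. pmf_of_set {..<n})) (\<lambda>j.
       return_pmf (\<lambda>(i, k). if i < s \<and> k < q then x i (j k) else False)))"

end

theory Submission
  imports Defs
begin

text \<open>
  Both distributions are mixtures over a tuple \<open>j\<close> of \<open>q\<close> uniform column indices and a tuple
  \<open>a\<close> of \<open>s\<close> weights drawn from \<open>\<eta>\<close>: the test matrix draws row \<open>i\<close> from \<open>cond_first \<xi> (a i)\<close> and
  reads off the columns \<open>j\<close>, the simulated one replaces that row by independent coins with the same
  one-coordinate marginals, which are exactly the types. If \<open>j\<close> is injective and \<open>e\<close>-independent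
  for every row distribution, the two conditional distributions are \<open>s e\<close>-close, one row at a time.
  All other samples have probability at most \<open>q\<^sup>2/n\<close> (a collision in \<open>j\<close>) plus \<open>s e\<close> (some \<open>a i\<close>
  outside the good set) plus \<open>s e\<close> (a dependent tuple), and \<open>3 s e + q\<^sup>2/n \<le> \<epsilon>\<close> for
  \<open>e = \<epsilon> / (3 (s + 1))\<close>.
\<close>

section \<open>Total variation distance\<close>

lemma measure_bind_pmf:
  "measure_pmf.prob (bind_pmf p f) S = (\<integral>x. measure_pmf.prob (f x) S \<partial>p)"
  unfolding measure_pmf_bind
  by (rule measure_pmf.measure_bind[where N="count_space UNIV"])
     (auto intro: measurable_measure_pmf simp: measure_pmf_in_subprob_algebra)

lemma abs_prob_diff_le_1: "\<bar>measure_pmf.prob p S - measure_pmf.prob r S\<bar> \<le> 1"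
proof -
  have "0 \<le> measure_pmf.prob p S" "measure_pmf.prob p S \<le> 1"
    "0 \<le> measure_pmf.prob r S" "measure_pmf.prob r S \<le> 1"
    by auto
  then show ?thesis by linarith
qed

lemma abs_prob_diff_le_dTV: "\<bar>measure_pmf.prob p S - measure_pmf.prob r S\<bar> \<le> dTV p r"
  unfolding dTV_def
  by (rule cSUP_upper) (auto intro!: bdd_aboveI[where M=1] simp: abs_prob_diff_le_1)

lemma dTV_leI: "(\<And>S. \<bar>measure_pmf.prob p S - measure_pmf.prob r S\<bar> \<le> c) \<Longrightarrow> dTV p r \<le> c"
  unfolding dTV_def by (rule cSUP_least) auto

lemma dTV_nonneg: "0 \<le> dTV p r"
  using abs_prob_diff_le_dTV[of p "{}" r] by simp

lemma dTV_le_1: "dTV p r \<le> 1"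
  by (rule dTV_leI) (rule abs_prob_diff_le_1)

lemma dTV_self [simp]: "dTV p p = 0"
  using dTV_leI[of p p 0] dTV_nonneg[of p p] by simp

lemma dTV_commute: "dTV p r = dTV r p"
  unfolding dTV_def by (simp add: abs_minus_commute)

lemma dTV_triangle: "dTV p r \<le> dTV p u + dTV u r"
proof (rule dTV_leI)
  fix S
  have "\<bar>measure_pmf.prob p S - measure_pmf.prob r S\<bar> \<le>
     \<bar>measure_pmf.prob p S - measure_pmf.prob u S\<bar> + \<bar>measure_pmf.prob u S - measure_pmf.prob r S\<bar>"
    by linarith
  also have "\<dots> \<le> dTV p u + dTV u r"
    by (intro add_mono abs_prob_diff_le_dTV)
  finally show "\<bar>measure_pmf.prob p S - measure_pmf.prob r S\<bar> \<le> dTV p u + dTV u r" .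
qed

lemma dTV_map_pmf: "dTV (map_pmf h p) (map_pmf h r) \<le> dTV p r"
  by (rule dTV_leI) (simp add: measure_map_pmf abs_prob_diff_le_dTV)

lemma dTV_bind_pmf:
  assumes "\<And>x. x \<in> set_pmf p \<Longrightarrow> dTV (f x) (g x) \<le> h x"
    and "\<And>x. 0 \<le> h x" and "\<And>x. h x \<le> B"
  shows "dTV (bind_pmf p f) (bind_pmf p g) \<le> measure_pmf.expectation p h"
proof (rule dTV_leI)
  fix S
  have int_f: "integrable p (\<lambda>x. measure_pmf.prob (f x) S)"
    and int_g: "integrable p (\<lambda>x. measure_pmf.prob (g x) S)"
    by (auto intro: measure_pmf.integrable_const_bound[where B=1])
  have int_h: "integrable p h"
    by (rule measure_pmf.integrable_const_bound[where B=B]) (use assms in \<open>auto intro: order.trans\<close>)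
  have "\<bar>measure_pmf.prob (bind_pmf p f) S - measure_pmf.prob (bind_pmf p g) S\<bar>
      = \<bar>\<integral>x. measure_pmf.prob (f x) S - measure_pmf.prob (g x) S \<partial>p\<bar>"
    by (simp add: measure_bind_pmf int_f int_g)
  also have "\<dots> \<le> (\<integral>x. \<bar>measure_pmf.prob (f x) S - measure_pmf.prob (g x) S\<bar> \<partial>p)"
    by (rule integral_abs_bound)
  also have "\<dots> \<le> measure_pmf.expectation p h"
    by (rule integral_mono_AE)
       (use int_f int_g int_h assms(1) in \<open>auto simp: AE_measure_pmf_iff intro: order.trans[OF abs_prob_diff_le_dTV]\<close>)
  finally show "\<bar>measure_pmf.prob (bind_pmf p f) S - measure_pmf.prob (bind_pmf p g) S\<bar>
      \<le> measure_pmf.expectation p h" .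
qed

lemma pair_pmf_eq_bind_map: "pair_pmf p q = bind_pmf p (\<lambda>x. map_pmf (Pair x) q)"
  by (simp add: pair_pmf_def map_pmf_def)

lemma dTV_pair_pmf: "dTV (pair_pmf p1 q1) (pair_pmf p2 q2) \<le> dTV p1 p2 + dTV q1 q2"
proof -
  have "dTV (pair_pmf p1 q1) (pair_pmf p2 q1) =
     dTV (map_pmf (\<lambda>(x, y). (y, x)) (pair_pmf q1 p1)) (map_pmf (\<lambda>(x, y). (y, x)) (pair_pmf q1 p2))"
    by (metis pair_commute_pmf)
  also have "\<dots> \<le> dTV (pair_pmf q1 p1) (pair_pmf q1 p2)"
    by (rule dTV_map_pmf)
  also have "\<dots> \<le> measure_pmf.expectation q1 (\<lambda>_. dTV p1 p2)"
    unfolding pair_pmf_eq_bind_map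
    by (rule dTV_bind_pmf[where B="dTV p1 p2"]) (auto intro: dTV_map_pmf dTV_nonneg)
  finally have left: "dTV (pair_pmf p1 q1) (pair_pmf p2 q1) \<le> dTV p1 p2"
    by simp
  have "dTV (pair_pmf p2 q1) (pair_pmf p2 q2) \<le> measure_pmf.expectation p2 (\<lambda>_. dTV q1 q2)"
    unfolding pair_pmf_eq_bind_map
    by (rule dTV_bind_pmf[where B="dTV q1 q2"]) (auto intro: dTV_map_pmf dTV_nonneg)
  then have right: "dTV (pair_pmf p2 q1) (pair_pmf p2 q2) \<le> dTV q1 q2"
    by simp
  show ?thesis
    using dTV_triangle[of "pair_pmf p1 q1" "pair_pmf p2 q2" "pair_pmf p2 q1"] left right by linarith
qed

lemma dTV_Pi_pmf:
  assumes "finite I"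
  shows "dTV (Pi_pmf I d p) (Pi_pmf I d r) \<le> (\<Sum>i\<in>I. dTV (p i) (r i))"
  using assms
proof (induction I rule: finite_induct)
  case empty
  then show ?case by simp
next
  case (insert x F)
  have "dTV (Pi_pmf (insert x F) d p) (Pi_pmf (insert x F) d r)
      = dTV (map_pmf (\<lambda>(y,f). f(x:=y)) (pair_pmf (p x) (Pi_pmf F d p)))
            (map_pmf (\<lambda>(y,f). f(x:=y)) (pair_pmf (r x) (Pi_pmf F d r)))"
    using insert by (simp add: Pi_pmf_insert)
  also have "\<dots> \<le> dTV (pair_pmf (p x) (Pi_pmf F d p)) (pair_pmf (r x) (Pi_pmf F d r))"
    by (rule dTV_map_pmf)
  also have "\<dots> \<le> dTV (p x) (r x) + dTV (Pi_pmf F d p) (Pi_pmf F d r)"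
    by (rule dTV_pair_pmf)
  also have "\<dots> \<le> (\<Sum>i\<in>insert x F. dTV (p i) (r i))"
    using insert by simp
  finally show ?case .
qed

lemma Pi_pmf_reindex:
  assumes "finite A" "bij_betw h A B" "\<And>x. x \<notin> A \<Longrightarrow> h x \<notin> B"
  shows "Pi_pmf A dflt (\<lambda>x. p (h x)) = map_pmf (\<lambda>g. g \<circ> h) (Pi_pmf B dflt p)"
    (is "?lhs = ?rhs")
proof -
  have B: "finite B"
    using assms bij_betw_finite by auto
  have "pmf ?lhs g = pmf ?rhs g" for g
  proof (cases "\<forall>a. a \<notin> A \<longrightarrow> g a = dflt")
    case True
    define h' where "h' = the_inv_into A h"
    have h': "h' (h x) = x" if "x \<in> A" for x
      unfolding h'_def using that assms by (auto simp add: bij_betw_def the_inv_into_f_f)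
    have h: "h (h' x) = x" if "x \<in> B" for x
      unfolding h'_def using that assms f_the_inv_into_f_bij_betw by fastforce
    have "pmf ?rhs g = measure_pmf.prob (Pi_pmf B dflt p) ((\<lambda>g. g \<circ> h) -` {g})"
      unfolding pmf_map by simp
    also have "\<dots> = measure_pmf.prob (Pi_pmf B dflt p)
                                (((\<lambda>g. g \<circ> h) -` {g}) \<inter> PiE_dflt B dflt (\<lambda>_. UNIV))"
      using B by (intro measure_prob_cong_0) (auto simp: PiE_dflt_def pmf_Pi_outside)
    also have "\<dots> = pmf (Pi_pmf B dflt p) (\<lambda>x. if x \<in> B then g (h' x) else dflt)"
    proof -
      have "(if h x \<in> B then g (h' (h x)) else dflt) = g x" for x
        using h' assms True by (cases "x \<in> A") (auto simp add: bij_betwE)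
      then have "(\<lambda>g. g \<circ> h) -` {g} \<inter> PiE_dflt B dflt (\<lambda>_. UNIV) =
            {(\<lambda>x. if x \<in> B then g (h' x) else dflt)}"
        using assms h' h True unfolding PiE_dflt_def by auto
      then show ?thesis
        by (simp add: measure_pmf_single)
    qed
    also have "\<dots> = (\<Prod>x\<in>B. pmf (p x) (g (h' x)))"
      using B by (simp add: pmf_Pi)
    also have "\<dots> = (\<Prod>x\<in>A. pmf (p (h x)) (g (h' (h x))))"
      using assms(2) by (rule prod.reindex_bij_betw[symmetric])
    also have "\<dots> = (\<Prod>x\<in>A. pmf (p (h x)) (g x))"
      by (intro prod.cong) (auto simp: h')
    also have "\<dots> = pmf ?lhs g"
      using assms True by (simp add: pmf_Pi)
    finally show ?thesis
      by simp
  next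
    case False
    have "pmf ?rhs g = infsetsum (pmf (Pi_pmf B dflt p)) ((\<lambda>g. g \<circ> h) -` {g})"
      using assms by (auto simp add: measure_pmf_conv_infsetsum pmf_map)
    also have "\<dots> = infsetsum (\<lambda>_. 0) ((\<lambda>g x. g (h x)) -` {g})"
      using B False assms by (intro infsetsum_cong pmf_Pi_outside) fastforce+
    also have "\<dots> = 0"
      by simp
    finally show ?thesis
      using assms False by (auto simp add: pmf_Pi pmf_map)
  qed
  then show ?thesis
    by (rule pmf_eqI)
qed

lemma Pi_pmf_uncurry:
  assumes "finite I" "finite K"
  shows "Pi_pmf (I \<times> K) d (\<lambda>(i,k). P i k) =
         map_pmf (\<lambda>X (i,k). X i k) (Pi_pmf I (\<lambda>_. d) (\<lambda>i. Pi_pmf K d (P i)))"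
proof (rule pmf_eqI)
  fix m :: "'a \<times> 'b \<Rightarrow> 'c"
  have inj: "inj (\<lambda>(X::'a \<Rightarrow> 'b \<Rightarrow> 'c) (i,k). X i k)"
    by (rule injI) (metis curry_case_prod)
  have m: "m = (\<lambda>(i,k). curry m i k)" by auto
  have "pmf (map_pmf (\<lambda>X (i,k). X i k) (Pi_pmf I (\<lambda>_. d) (\<lambda>i. Pi_pmf K d (P i)))) m
      = pmf (Pi_pmf I (\<lambda>_. d) (\<lambda>i. Pi_pmf K d (P i))) (curry m)"
    by (subst m, subst pmf_map_inj'[OF inj]) simp
  also have "\<dots> = pmf (Pi_pmf (I \<times> K) d (\<lambda>(i,k). P i k)) m"
  proof (cases "\<forall>x. x \<notin> I \<times> K \<longrightarrow> m x = d")
    case True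
    then have "pmf (Pi_pmf I (\<lambda>_. d) (\<lambda>i. Pi_pmf K d (P i))) (curry m)
        = (\<Prod>i\<in>I. \<Prod>k\<in>K. pmf (P i k) (m (i,k)))"
      using assms by (auto simp: pmf_Pi curry_def fun_eq_iff intro!: prod.cong)
    also have "\<dots> = (\<Prod>x\<in>I \<times> K. pmf ((\<lambda>(i,k). P i k) x) (m x))"
      by (simp add: prod.cartesian_product case_prod_unfold)
    also have "\<dots> = pmf (Pi_pmf (I \<times> K) d (\<lambda>(i,k). P i k)) m"
      using True assms by (simp add: pmf_Pi)
    finally show ?thesis .
  next
    case False
    then have "curry m \<notin> set_pmf (Pi_pmf I (\<lambda>_. d) (\<lambda>i. Pi_pmf K d (P i)))"
      using assms by (auto simp: set_Pi_pmf PiE_dflt_def fun_eq_iff)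
    then show ?thesis
      using False assms by (simp add: set_pmf_iff pmf_Pi_outside)
  qed
  finally show "pmf (Pi_pmf (I \<times> K) d (\<lambda>(i,k). P i k)) m =
     pmf (map_pmf (\<lambda>X (i,k). X i k) (Pi_pmf I (\<lambda>_. d) (\<lambda>i. Pi_pmf K d (P i)))) m" ..
qed

lemma map_pmf_bool_eq_bernoulli:
  "map_pmf (f :: 'x \<Rightarrow> bool) \<nu> = bernoulli_pmf (measure_pmf.prob \<nu> {x. f x})"
proof (rule pmf_eqI)
  fix b :: bool
  have p: "0 \<le> measure_pmf.prob \<nu> {x. f x}" "measure_pmf.prob \<nu> {x. f x} \<le> 1"
    by auto
  have "f -` {False} = UNIV - {x. f x}"
    by auto
  then have "measure_pmf.prob \<nu> (f -` {False}) = 1 - measure_pmf.prob \<nu> {x. f x}"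
    by (simp add: measure_pmf.prob_compl[symmetric] Compl_eq_Diff_UNIV)
  then show "pmf (map_pmf f \<nu>) b = pmf (bernoulli_pmf (measure_pmf.prob \<nu> {x. f x})) b"
    using p by (cases b) (simp_all add: pmf_map vimage_def)
qed

definition select_columns :: "nat \<Rightarrow> nat \<Rightarrow> (nat \<Rightarrow> nat) \<Rightarrow> (nat \<Rightarrow> nat \<Rightarrow> bool) \<Rightarrow> nat \<times> nat \<Rightarrow> bool"
  where "select_columns s q j x = (\<lambda>(i, k). if i < s \<and> k < q then x i (j k) else False)"

lemma dTV_Pi_pmf_marginals_le:
  fixes \<nu> :: "(nat \<Rightarrow> bool) pmf" and j :: "nat \<Rightarrow> nat"
  assumes inj: "inj_on j {..<q}" and ind: "eps_independent e \<nu> (map j [0..<q])"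
  shows "dTV (Pi_pmf {..<q} False (\<lambda>k. map_pmf (\<lambda>x. x (j k)) \<nu>))
             (map_pmf (\<lambda>x k. if k < q then x (j k) else False) \<nu>) \<le> e"
proof -
  define JS where "JS = j ` {..<q}"
  obtain m where m: "m \<notin> JS"
    using ex_new_if_finite[OF infinite_UNIV_nat, of JS] unfolding JS_def by auto
  define jj where "jj = (\<lambda>k. if k < q then j k else m)"
  define R where "R = (\<lambda>(x::nat \<Rightarrow> bool) k. if k < q then x (j k) else False)"
  have bij: "bij_betw jj {..<q} JS"
    unfolding bij_betw_def JS_def jj_def using inj by (auto simp: inj_on_def image_def)
  have out: "\<And>x. x \<notin> {..<q} \<Longrightarrow> jj x \<notin> JS"
    using m unfolding jj_def by auto
  have "Pi_pmf {..<q} False (\<lambda>k. map_pmf (\<lambda>x. x (j k)) \<nu>)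
      = Pi_pmf {..<q} False (\<lambda>k. (\<lambda>i. map_pmf (\<lambda>x. x i) \<nu>) (jj k))"
    by (rule Pi_pmf_cong) (auto simp: jj_def)
  also have "\<dots> = map_pmf (\<lambda>g. g \<circ> jj) (prod_marginals JS \<nu>)"
    unfolding prod_marginals_def by (rule Pi_pmf_reindex[OF _ bij out]) auto
  also have "\<dots> = map_pmf R (prod_marginals JS \<nu>)"
    unfolding prod_marginals_def
  proof (rule map_pmf_cong[OF refl])
    fix g assume "g \<in> set_pmf (Pi_pmf JS False (\<lambda>i. map_pmf (\<lambda>x. x i) \<nu>))"
    then have "\<forall>x. x \<notin> JS \<longrightarrow> g x = False"
      using set_Pi_pmf_subset[of JS False] unfolding JS_def by blast
    then show "g \<circ> jj = R g"
      using out unfolding R_def jj_def by (auto simp: fun_eq_iff)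
  qed
  finally have marginals: "Pi_pmf {..<q} False (\<lambda>k. map_pmf (\<lambda>x. x (j k)) \<nu>)
      = map_pmf R (prod_marginals JS \<nu>)" .
  have joint: "map_pmf R \<nu> = map_pmf R (proj_pmf JS \<nu>)"
    unfolding proj_pmf_def map_pmf_comp R_def JS_def by (intro map_pmf_cong) (auto simp: fun_eq_iff)
  have "dTV (map_pmf R (prod_marginals JS \<nu>)) (map_pmf R (proj_pmf JS \<nu>))
      \<le> dTV (prod_marginals JS \<nu>) (proj_pmf JS \<nu>)"
    by (rule dTV_map_pmf)
  also have "\<dots> \<le> e"
    using ind unfolding eps_independent_def by (simp add: JS_def dTV_commute atLeast0LessThan)
  finally show ?thesis
    using marginals joint unfolding R_def by simp
qed

lemma map_select_columns_Pi_pmf: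
  "map_pmf (select_columns s q j) (Pi_pmf {..<s} (\<lambda>_. False) \<rho>)
   = map_pmf (\<lambda>X (i, k). X i k)
       (Pi_pmf {..<s} (\<lambda>_. False) (\<lambda>i. map_pmf (\<lambda>x k. if k < q then x (j k) else False) (\<rho> i)))"
proof -
  define R where "R = (\<lambda>(x::nat \<Rightarrow> bool) k. if k < q then x (j k) else False)"
  have "Pi_pmf {..<s} (\<lambda>_. False) (\<lambda>i. map_pmf R (\<rho> i))
      = map_pmf (\<lambda>h. R \<circ> h) (Pi_pmf {..<s} (\<lambda>_. False) \<rho>)"
    by (rule Pi_pmf_map) (auto simp: R_def fun_eq_iff)
  then have "map_pmf (\<lambda>X (i, k). X i k) (Pi_pmf {..<s} (\<lambda>_. False) (\<lambda>i. map_pmf R (\<rho> i)))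
      = map_pmf (\<lambda>h (i, k). R (h i) k) (Pi_pmf {..<s} (\<lambda>_. False) \<rho>)"
    by (simp add: map_pmf_comp o_def)
  also have "\<dots> = map_pmf (select_columns s q j) (Pi_pmf {..<s} (\<lambda>_. False) \<rho>)"
  proof (rule map_pmf_cong[OF refl])
    fix h assume "h \<in> set_pmf (Pi_pmf {..<s} (\<lambda>_. False) \<rho>)"
    then have "\<forall>x. x \<notin> {..<s} \<longrightarrow> h x = (\<lambda>_. False)"
      using set_Pi_pmf_subset[of "{..<s}" "\<lambda>_. False" \<rho>] by blast
    then show "(\<lambda>(i, k). R (h i) k) = select_columns s q j h"
      unfolding R_def select_columns_def by (auto simp: fun_eq_iff)
  qed
  finally show ?thesis
    unfolding R_def ..
qed

text \<open>The coin matrix is the product over rows of the one-coordinate marginals of \<open>\<nu> (a i)\<close>;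
  total variation is subadditive over products.\<close>

lemma dTV_bernoulli_matrix_le:
  fixes \<nu> :: "'a \<Rightarrow> (nat \<Rightarrow> bool) pmf" and a :: "nat \<Rightarrow> 'a" and j :: "nat \<Rightarrow> nat"
    and T :: "nat \<Rightarrow> 'a \<Rightarrow> real"
  assumes inj: "inj_on j {..<q}"
    and ind: "\<And>i. i < s \<Longrightarrow> eps_independent e (\<nu> (a i)) (map j [0..<q])"
    and bias: "\<And>i k. i < s \<Longrightarrow> k < q \<Longrightarrow> T (j k) (a i) = measure_pmf.prob (\<nu> (a i)) {x. x (j k)}"
  shows "dTV (Pi_pmf ({..<s} \<times> {..<q}) False (\<lambda>(i, k). bernoulli_pmf (T (j k) (a i))))
            (map_pmf (select_columns s q j) (Pi_pmf {..<s} (\<lambda>_. False) (\<lambda>i. \<nu> (a i))))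
         \<le> real s * e"
proof -
  have "Pi_pmf ({..<s} \<times> {..<q}) False (\<lambda>(i, k). bernoulli_pmf (T (j k) (a i)))
      = Pi_pmf ({..<s} \<times> {..<q}) False (\<lambda>(i, k). map_pmf (\<lambda>x. x (j k)) (\<nu> (a i)))"
    by (rule Pi_pmf_cong) (auto simp: bias map_pmf_bool_eq_bernoulli)
  also have "\<dots> = map_pmf (\<lambda>X (i, k). X i k) (Pi_pmf {..<s} (\<lambda>_. False)
          (\<lambda>i. Pi_pmf {..<q} False (\<lambda>k. map_pmf (\<lambda>x. x (j k)) (\<nu> (a i)))))"
    by (rule Pi_pmf_uncurry) auto
  finally have coins: "Pi_pmf ({..<s} \<times> {..<q}) False (\<lambda>(i, k). bernoulli_pmf (T (j k) (a i))) = \<dots>" .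
  have "dTV (Pi_pmf {..<s} (\<lambda>_. False) (\<lambda>i. Pi_pmf {..<q} False (\<lambda>k. map_pmf (\<lambda>x. x (j k)) (\<nu> (a i)))))
            (Pi_pmf {..<s} (\<lambda>_. False) (\<lambda>i. map_pmf (\<lambda>x k. if k < q then x (j k) else False) (\<nu> (a i))))
     \<le> (\<Sum>i<s. dTV (Pi_pmf {..<q} False (\<lambda>k. map_pmf (\<lambda>x. x (j k)) (\<nu> (a i))))
                   (map_pmf (\<lambda>x k. if k < q then x (j k) else False) (\<nu> (a i))))"
    by (rule dTV_Pi_pmf) auto
  also have "\<dots> \<le> (\<Sum>i<s. e)"
    by (rule sum_mono) (use dTV_Pi_pmf_marginals_le[OF inj] ind in auto)
  also have "\<dots> = real s * e"
    by simp
  finally show ?thesis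
    unfolding coins map_select_columns_Pi_pmf by (rule order.trans[OF dTV_map_pmf])
qed

section \<open>Random index tuples\<close>

lemma measure_pmf_prob_UN_lessThan_le:
  assumes "\<And>i. i < s \<Longrightarrow> measure_pmf.prob p (B i) \<le> c"
  shows "measure_pmf.prob p (\<Union>i<s. B i) \<le> real s * c"
proof -
  have "measure_pmf.prob p (\<Union>i<s. B i) \<le> (\<Sum>i<s. measure_pmf.prob p (B i))"
    by (rule measure_pmf.finite_measure_subadditive_finite) auto
  also have "\<dots> \<le> (\<Sum>i<s. c)"
    by (rule sum_mono) (use assms in auto)
  finally show ?thesis
    by simp
qed

lemma measure_pair_pmf_le:
  assumes "\<And>y. y \<in> set_pmf q \<Longrightarrow> measure_pmf.prob p {x. (x, y) \<in> S} \<le> c"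
  shows "measure_pmf.prob (pair_pmf p q) S \<le> c"
proof -
  have "measure_pmf.prob (pair_pmf p q) S
      = (\<integral>y. measure_pmf.prob p {x. (x, y) \<in> S} \<partial>q)"
    by (subst pair_commute_pmf)
       (simp add: measure_map_pmf pair_pmf_eq_bind_map measure_bind_pmf vimage_def)
  also have "\<dots> \<le> (\<integral>y. c \<partial>q)"
    by (rule integral_mono_AE)
       (auto simp: AE_measure_pmf_iff assms intro!: measure_pmf.integrable_const_bound[where B=1])
  finally show ?thesis
    by simp
qed

lemma measure_pair_pmf_fst: "measure_pmf.prob (pair_pmf p q) {z. P (fst z)} = measure_pmf.prob p {x. P x}"
  using map_fst_pair_pmf[of p q] by (metis measure_map_pmf vimage_Collect_eq)

lemma measure_pair_pmf_snd: "measure_pmf.prob (pair_pmf p q) {z. P (snd z)} = measure_pmf.prob q {x. P x}"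
  using map_snd_pair_pmf[of p q] by (metis measure_map_pmf vimage_Collect_eq)

definition uniform_indices :: "nat \<Rightarrow> nat \<Rightarrow> (nat \<Rightarrow> nat) pmf"
  where "uniform_indices n q = Pi_pmf {..<q} 0 (\<lambda>_. pmf_of_set {..<n})"

lemma uniform_indices_less:
  assumes "0 < n" "j \<in> set_pmf (uniform_indices n q)" "k < q"
  shows "j k < n"
proof -
  have "set_pmf (pmf_of_set {..<n}) = {..<n}"
    using assms(1) by (intro set_pmf_of_set) auto
  then show ?thesis
    using assms by (auto simp: uniform_indices_def set_Pi_pmf PiE_dflt_def)
qed

lemma prob_uniform_indices_collision:
  assumes "k < q" "l < q" "k \<noteq> l" "0 < n"
  shows "measure_pmf.prob (uniform_indices n q) {j. j k = j l} \<le> 1 / real n"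
proof -
  define U where "U = pmf_of_set {..<n}"
  define rest where "rest = Pi_pmf ({..<q} - {k}) (0::nat) (\<lambda>_. U)"
  have "uniform_indices n q = Pi_pmf (insert k ({..<q} - {k})) 0 (\<lambda>_. U)"
    using assms(1) by (simp add: uniform_indices_def U_def insert_absorb)
  also have "\<dots> = map_pmf (\<lambda>(y, f). f(k := y)) (pair_pmf U rest)"
    unfolding rest_def by (rule Pi_pmf_insert) auto
  finally have "measure_pmf.prob (uniform_indices n q) {j. j k = j l}
      = measure_pmf.prob (pair_pmf U rest) {(y, f). y = f l}"
    using assms(3) by (simp add: measure_map_pmf vimage_def case_prod_unfold)
  also have "\<dots> \<le> 1 / real n"
  proof (rule measure_pair_pmf_le)
    fix f
    have "measure_pmf.prob U {y. (y, f) \<in> {(y, f). y = f l}} = real (card ({..<n} \<inter> {f l})) / real n"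
      using assms(4) by (simp add: U_def measure_pmf_of_set lessThan_empty_iff)
    also have "\<dots> \<le> 1 / real n"
      by (intro divide_right_mono) (auto simp: card_le_Suc0_iff_eq)
    finally show "measure_pmf.prob U {y. (y, f) \<in> {(y, f). y = f l}} \<le> 1 / real n" .
  qed
  finally show ?thesis .
qed

lemma prob_uniform_indices_not_inj:
  assumes "0 < n"
  shows "measure_pmf.prob (uniform_indices n q) {j. \<not> inj_on j {..<q}} \<le> real q * real q / real n"
proof -
  have collisions: "{j. \<not> inj_on j {..<q}} = (\<Union>k<q. \<Union>l<q. {j. k \<noteq> l \<and> j k = j l})"
    unfolding inj_on_def by auto
  have "measure_pmf.prob (uniform_indices n q) (\<Union>k<q. \<Union>l<q. {j. k \<noteq> l \<and> j k = j l})
      \<le> real q * (real q * (1 / real n))"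
  proof (intro measure_pmf_prob_UN_lessThan_le)
    fix k l assume "k < q" "l < q"
    then show "measure_pmf.prob (uniform_indices n q) {j. k \<noteq> l \<and> j k = j l} \<le> 1 / real n"
      using prob_uniform_indices_collision[of k q l n] assms by (cases "k = l") auto
  qed
  then show ?thesis
    unfolding collisions by simp
qed

lemma map_uniform_indices_eq_pmf_of_set:
  assumes "0 < n"
  shows "map_pmf (\<lambda>j. map j [0..<q]) (uniform_indices n q)
       = pmf_of_set {xs. set xs \<subseteq> {..<n} \<and> length xs = q}"
proof -
  define PD where "PD = PiE_dflt {..<q} (0::nat) (\<lambda>_. {..<n})"
  define li where "li = (\<lambda>j::nat \<Rightarrow> nat. map j [0..<q])"
  have uniform: "uniform_indices n q = pmf_of_set PD"
    unfolding PD_def uniform_indices_def using assms by (intro Pi_pmf_of_set) auto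
  have "finite PD"
    unfolding PD_def by (intro finite_PiE_dflt) auto
  moreover have "PD \<noteq> {}"
    using assms by (auto simp: PD_def PiE_dflt_def intro!: exI[of _ "\<lambda>_. 0"])
  moreover have "inj_on li PD"
    by (rule inj_onI) (auto simp: PD_def PiE_dflt_def li_def fun_eq_iff map_eq_conv)
  moreover have "li ` PD = {xs. set xs \<subseteq> {..<n} \<and> length xs = q}"
  proof (intro equalityI subsetI)
    fix xs assume "xs \<in> {xs. set xs \<subseteq> {..<n} \<and> length xs = q}"
    then have "li (\<lambda>k. if k < q then xs ! k else 0) = xs" "(\<lambda>k. if k < q then xs ! k else 0) \<in> PD"
      by (auto simp: li_def PD_def PiE_dflt_def intro: nth_equalityI dest: nth_mem)
    then show "xs \<in> li ` PD"
      by (metis imageI)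
  qed (auto simp: PD_def PiE_dflt_def li_def)
  ultimately show ?thesis
    unfolding uniform li_def[symmetric] by (simp add: map_pmf_of_set_inj)
qed

lemma prob_uniform_indices_dependent:
  assumes "0 < n" "0 \<le> e" and good: "good_dist n e q \<nu>"
  shows "measure_pmf.prob (uniform_indices n q)
           {j. inj_on j {..<q} \<and> \<not> eps_independent e \<nu> (map j [0..<q])} \<le> e"
proof -
  define L where "L = {xs. set xs \<subseteq> {..<n} \<and> length xs = q}"
  define Ind where "Ind = {js \<in> tuples n q. eps_independent e \<nu> js}"
  define Bd where "Bd = {js \<in> tuples n q. \<not> eps_independent e \<nu> js}"
  have finL: "finite L"
    unfolding L_def by (rule finite_lists_length_eq) auto
  have L: "L \<noteq> {}"
    unfolding L_def by (auto intro!: exI[of _ "replicate q 0"] simp: assms(1))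
  have tuples_L: "tuples n q \<subseteq> L"
    by (auto simp: tuples_def L_def)
  then have "finite (tuples n q)"
    using finL by (rule finite_subset)
  then have "card (tuples n q) = card Ind + card Bd"
    unfolding Ind_def Bd_def by (subst card_Un_disjoint[symmetric]) (auto intro!: arg_cong[where f=card])
  then have "real (card Bd) \<le> e * real (card (tuples n q))"
    using good unfolding good_dist_def Ind_def[symmetric] by (simp add: algebra_simps)
  also have "\<dots> \<le> e * real (card L)"
    using card_mono[OF finL tuples_L] assms(2) by (simp add: mult_left_mono)
  finally have card_Bd: "real (card Bd) \<le> e * real (card L)" .
  have "{j. inj_on j {..<q} \<and> \<not> eps_independent e \<nu> (map j [0..<q])} \<inter> set_pmf (uniform_indices n q)
      \<subseteq> (\<lambda>j. map j [0..<q]) -` Bd"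
    using uniform_indices_less[OF assms(1)]
    by (auto simp: Bd_def tuples_def distinct_map atLeast0LessThan)
  then have "measure_pmf.prob (uniform_indices n q)
      {j. inj_on j {..<q} \<and> \<not> eps_independent e \<nu> (map j [0..<q])}
      \<le> measure_pmf.prob (uniform_indices n q) ((\<lambda>j. map j [0..<q]) -` Bd)"
    by (subst measure_Int_set_pmf[symmetric]) (rule measure_pmf.finite_measure_mono, auto)
  also have "\<dots> = measure_pmf.prob (pmf_of_set L) Bd"
    by (simp add: measure_map_pmf[symmetric] map_uniform_indices_eq_pmf_of_set[OF assms(1)] L_def)
  also have "\<dots> = real (card Bd) / real (card L)"
    using finL L tuples_L by (simp add: measure_pmf_of_set Int_absorb1 Bd_def subset_iff)
  also have "\<dots> \<le> e"
    using card_Bd finL L by (simp add: divide_le_eq)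
  finally show ?thesis .
qed

section \<open>The two matrix distributions as mixtures\<close>

lemma map_fst_eq_bind_cond_first: "map_pmf fst \<xi> = bind_pmf (weight_dist \<xi>) (cond_first \<xi>)"
proof -
  have "bind_pmf (map_pmf snd \<xi>) (\<lambda>a. cond_pmf \<xi> {z. snd z = a}) = \<xi>"
    by (rule bind_cond_pmf_cancel) (auto simp: measure_map_pmf vimage_def eq_commute)
  then have "map_pmf fst \<xi> = map_pmf fst (bind_pmf (map_pmf snd \<xi>) (\<lambda>a. cond_pmf \<xi> {z. snd z = a}))"
    by simp
  then show ?thesis
    by (simp add: map_bind_pmf weight_dist_def cond_first_def[abs_def])
qed

lemma bind_pmf_bind_pmf_eq_pair:
  "bind_pmf p (\<lambda>x. bind_pmf q (F x)) = bind_pmf (pair_pmf p q) (\<lambda>z. F (fst z) (snd z))"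
  by (simp add: pair_pmf_def bind_assoc_pmf bind_return_pmf)

lemma D_sim_no_columns_eq_D_test: "D_sim s 0 \<eta> \<Lambda> = D_test n s 0 \<mu>"
  by (simp add: D_sim_def D_test_def bind_return_pmf fun_eq_iff case_prod_unfold)

text \<open>Drawing \<open>q\<close> types from \<open>\<Lambda>\<close> is drawing \<open>q\<close> uniform indices and taking their types; the
  default values of the two products differ, but only outside \<open>{..<q}\<close>, where they are never read.\<close>

lemma D_sim_as_mixture:
  "D_sim s q (weight_dist \<xi>) (type_dist n \<xi>) =
   bind_pmf (uniform_indices n q) (\<lambda>j.
   bind_pmf (Pi_pmf {..<s} undefined (\<lambda>_. weight_dist \<xi>)) (\<lambda>a.
     Pi_pmf ({..<s} \<times> {..<q}) False (\<lambda>(i, k). bernoulli_pmf (type_of \<xi> (j k) (a i)))))"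
proof -
  define T where "T = type_of \<xi>"
  define g where "g = (\<lambda>(f::nat \<Rightarrow> 'a \<Rightarrow> real) x. if x \<in> {..<q} then f x else (\<lambda>_. 0))"
  have "Pi_pmf {..<q} (\<lambda>_. 0) (\<lambda>_. map_pmf T (pmf_of_set {..<n}))
     = map_pmf g (Pi_pmf {..<q} (T 0) (\<lambda>_. map_pmf T (pmf_of_set {..<n})))"
    unfolding g_def by (rule Pi_pmf_default_swap[symmetric]) auto
  also have "Pi_pmf {..<q} (T 0) (\<lambda>_. map_pmf T (pmf_of_set {..<n}))
      = map_pmf (\<lambda>h. T \<circ> h) (uniform_indices n q)"
    unfolding uniform_indices_def by (rule Pi_pmf_map) auto
  finally have types: "Pi_pmf {..<q} (\<lambda>_. 0) (\<lambda>_. map_pmf T (pmf_of_set {..<n}))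
      = map_pmf (\<lambda>h. g (T \<circ> h)) (uniform_indices n q)"
    by (simp add: map_pmf_comp)
  show ?thesis
    unfolding D_sim_def type_dist_def T_def[symmetric] types bind_map_pmf
    by (intro bind_pmf_cong refl Pi_pmf_cong) (auto simp: g_def)
qed

lemma D_test_as_mixture:
  "D_test n s q (map_pmf fst \<xi>) =
   bind_pmf (uniform_indices n q) (\<lambda>j.
   bind_pmf (Pi_pmf {..<s} undefined (\<lambda>_. weight_dist \<xi>)) (\<lambda>a.
     map_pmf (select_columns s q j) (Pi_pmf {..<s} (\<lambda>_. False) (\<lambda>i. cond_first \<xi> (a i)))))"
proof -
  have rows: "Pi_pmf {..<s} (\<lambda>_. False) (\<lambda>_. map_pmf fst \<xi>)
     = bind_pmf (Pi_pmf {..<s} undefined (\<lambda>_. weight_dist \<xi>))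
         (\<lambda>a. Pi_pmf {..<s} (\<lambda>_. False) (\<lambda>i. cond_first \<xi> (a i)))"
    unfolding map_fst_eq_bind_cond_first by (rule Pi_pmf_bind) auto
  show ?thesis
    unfolding D_test_def uniform_indices_def select_columns_def
    by (subst bind_commute_pmf) (simp add: map_pmf_def[symmetric] rows map_bind_pmf)
qed

definition good_sample ::
    "((nat \<Rightarrow> bool) \<times> 'a) pmf \<Rightarrow> real \<Rightarrow> nat \<Rightarrow> nat \<Rightarrow> (nat \<Rightarrow> nat) \<Rightarrow> (nat \<Rightarrow> 'a) \<Rightarrow> bool"
  where "good_sample \<xi> e s q j a \<longleftrightarrow> inj_on j {..<q} \<and>
    (\<forall>i<s. 0 < pmf (weight_dist \<xi>) (a i) \<and> eps_independent e (cond_first \<xi> (a i)) (map j [0..<q]))"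

lemma dTV_D_sim_D_test_le:
  fixes n q s :: nat and \<xi> :: "((nat \<Rightarrow> bool) \<times> 'a) pmf"
  assumes "0 \<le> e"
  defines "P \<equiv> pair_pmf (uniform_indices n q) (Pi_pmf {..<s} undefined (\<lambda>_. weight_dist \<xi>))"
  shows "dTV (D_sim s q (weight_dist \<xi>) (type_dist n \<xi>)) (D_test n s q (map_pmf fst \<xi>))
         \<le> real s * e + measure_pmf.prob P {z. \<not> good_sample \<xi> e s q (fst z) (snd z)}"
proof -
  define Bad where "Bad = {z. \<not> good_sample \<xi> e s q (fst z) (snd z)}"
  define Sim where "Sim = (\<lambda>j a.
     Pi_pmf ({..<s} \<times> {..<q}) False (\<lambda>(i, k). bernoulli_pmf (type_of \<xi> (j k) (a i))))"
  define Test where "Test = (\<lambda>j a.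
     map_pmf (select_columns s q j) (Pi_pmf {..<s} (\<lambda>_. False) (\<lambda>i. cond_first \<xi> (a i))))"
  have sim: "D_sim s q (weight_dist \<xi>) (type_dist n \<xi>) = bind_pmf P (\<lambda>z. Sim (fst z) (snd z))"
    unfolding D_sim_as_mixture P_def Sim_def by (rule bind_pmf_bind_pmf_eq_pair)
  have test: "D_test n s q (map_pmf fst \<xi>) = bind_pmf P (\<lambda>z. Test (fst z) (snd z))"
    unfolding D_test_as_mixture P_def Test_def by (rule bind_pmf_bind_pmf_eq_pair)
  have pointwise: "dTV (Sim (fst z) (snd z)) (Test (fst z) (snd z)) \<le> real s * e + indicator Bad z" for z
  proof (cases "z \<in> Bad")
    case True
    have "0 \<le> real s * e"
      using assms(1) by simp
    then show ?thesis
      using True dTV_le_1[of "Sim (fst z) (snd z)" "Test (fst z) (snd z)"] by simp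
  next
    case False
    then have good: "good_sample \<xi> e s q (fst z) (snd z)"
      by (simp add: Bad_def)
    have "dTV (Sim (fst z) (snd z)) (Test (fst z) (snd z)) \<le> real s * e"
      unfolding Sim_def Test_def
      by (rule dTV_bernoulli_matrix_le) (use good in \<open>auto simp: good_sample_def type_of_def\<close>)
    then show ?thesis
      using False by simp
  qed
  have "dTV (D_sim s q (weight_dist \<xi>) (type_dist n \<xi>)) (D_test n s q (map_pmf fst \<xi>))
      \<le> measure_pmf.expectation P (\<lambda>z. real s * e + indicator Bad z)"
    unfolding sim test
    by (rule dTV_bind_pmf[where B="real s * e + 1"]) (use pointwise assms(1) in \<open>auto simp: indicator_def\<close>)
  also have "\<dots> = real s * e + measure_pmf.prob P Bad"
    by (simp add: Bochner_Integration.integral_add measure_pmf.emeasure_eq_measure)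
  finally show ?thesis
    unfolding Bad_def .
qed

text \<open>The event that \<open>j\<close> is dependent for some \<open>a i \<in> G\<close> is bounded conditionally on \<open>a\<close>.\<close>

lemma prob_not_good_sample_le:
  fixes n q s :: nat and \<xi> :: "((nat \<Rightarrow> bool) \<times> 'a) pmf"
  assumes "0 < n" "0 \<le> e"
    and G: "1 - e \<le> measure_pmf.prob (weight_dist \<xi>) G"
    and G_good: "\<And>a. a \<in> G \<Longrightarrow> 0 < pmf (weight_dist \<xi>) a \<and> good_dist n e q (cond_first \<xi> a)"
  defines "P \<equiv> pair_pmf (uniform_indices n q) (Pi_pmf {..<s} undefined (\<lambda>_. weight_dist \<xi>))"
  shows "measure_pmf.prob P {z. \<not> good_sample \<xi> e s q (fst z) (snd z)}
         \<le> real q * real q / real n + 2 * (real s * e)"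
proof -
  define Dep where "Dep = (\<lambda>i::nat. {z. snd z i \<in> G \<and> inj_on (fst z) {..<q} \<and>
      \<not> eps_independent e (cond_first \<xi> (snd z i)) (map (fst z) [0..<q])})"
  have "measure_pmf.prob P {z. \<not> inj_on (fst z) {..<q}}
      = measure_pmf.prob (uniform_indices n q) {j. \<not> inj_on j {..<q}}"
    unfolding P_def by (rule measure_pair_pmf_fst[where P="\<lambda>j. \<not> inj_on j {..<q}"])
  also have "\<dots> \<le> real q * real q / real n"
    by (rule prob_uniform_indices_not_inj[OF assms(1)])
  finally have collision: "measure_pmf.prob P {z. \<not> inj_on (fst z) {..<q}} \<le> real q * real q / real n" .
  have outside: "measure_pmf.prob P (\<Union>i<s. {z. snd z i \<notin> G}) \<le> real s * e"
  proof (rule measure_pmf_prob_UN_lessThan_le)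
    fix i assume "i < s"
    have "measure_pmf.prob P {z. snd z i \<notin> G}
        = measure_pmf.prob (Pi_pmf {..<s} undefined (\<lambda>_. weight_dist \<xi>)) {a. a i \<notin> G}"
      unfolding P_def by (rule measure_pair_pmf_snd[where P="\<lambda>a. a i \<notin> G"])
    also have "\<dots> = measure_pmf.prob (map_pmf (\<lambda>a. a i) (Pi_pmf {..<s} undefined (\<lambda>_. weight_dist \<xi>))) (UNIV - G)"
      by (simp add: measure_map_pmf vimage_def)
    also have "\<dots> = measure_pmf.prob (weight_dist \<xi>) (UNIV - G)"
      using \<open>i < s\<close> by (simp add: Pi_pmf_component)
    also have "\<dots> \<le> e"
      using G measure_pmf.prob_compl[of G "weight_dist \<xi>"] by simp
    finally show "measure_pmf.prob P {z. snd z i \<notin> G} \<le> e" .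
  qed
  have dependent: "measure_pmf.prob P (\<Union>i<s. Dep i) \<le> real s * e"
  proof (rule measure_pmf_prob_UN_lessThan_le)
    fix i
    show "measure_pmf.prob P (Dep i) \<le> e"
      unfolding P_def
    proof (rule measure_pair_pmf_le)
      fix a
      show "measure_pmf.prob (uniform_indices n q) {j. (j, a) \<in> Dep i} \<le> e"
      proof (cases "a i \<in> G")
        case True
        then show ?thesis
          using prob_uniform_indices_dependent[OF assms(1,2)] G_good by (simp add: Dep_def)
      next
        case False
        then show ?thesis
          using assms(2) by (simp add: Dep_def)
      qed
    qed
  qed
  have "{z. \<not> good_sample \<xi> e s q (fst z) (snd z)}
      \<subseteq> {z. \<not> inj_on (fst z) {..<q}} \<union> (\<Union>i<s. {z. snd z i \<notin> G}) \<union> (\<Union>i<s. Dep i)"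
    using G_good by (auto simp: good_sample_def Dep_def)
  then have "measure_pmf.prob P {z. \<not> good_sample \<xi> e s q (fst z) (snd z)}
      \<le> measure_pmf.prob P ({z. \<not> inj_on (fst z) {..<q}} \<union> (\<Union>i<s. {z. snd z i \<notin> G}) \<union> (\<Union>i<s. Dep i))"
    by (rule measure_pmf.finite_measure_mono) simp
  also have "\<dots> \<le> measure_pmf.prob P {z. \<not> inj_on (fst z) {..<q}}
      + measure_pmf.prob P (\<Union>i<s. {z. snd z i \<notin> G}) + measure_pmf.prob P (\<Union>i<s. Dep i)"
    using measure_Un_le[of "{z. \<not> inj_on (fst z) {..<q}} \<union> (\<Union>i<s. {z. snd z i \<notin> G})" P "\<Union>i<s. Dep i"]
      measure_Un_le[of "{z. \<not> inj_on (fst z) {..<q}}" P "\<Union>i<s. {z. snd z i \<notin> G}"]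
    by simp
  finally show ?thesis
    using collision outside dependent by linarith
qed

lemma error_budget:
  fixes \<epsilon> :: real
  assumes "0 < \<epsilon>" "6 * real q ^ 2 * (real s + 1) / \<epsilon> \<le> real n"
  shows "real s * (\<epsilon> / (3 * (real s + 1))) + (real q * real q / real n
           + 2 * (real s * (\<epsilon> / (3 * (real s + 1))))) \<le> \<epsilon>"
proof -
  have collisions: "real q * real q / real n \<le> \<epsilon> / (6 * (real s + 1))"
  proof (cases "n = 0")
    case True
    then show ?thesis
      using assms(1) by simp
  next
    case False
    then have "0 < real n"
      by simp
    moreover have "real q * real q * (6 * (real s + 1)) \<le> \<epsilon> * real n"
      using assms by (simp add: divide_le_eq power2_eq_square algebra_simps)
    ultimately show ?thesis
      by (simp add: field_simps)
  qed
  have "real s * (\<epsilon> / (3 * (real s + 1))) + 2 * (real s * (\<epsilon> / (3 * (real s + 1))))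
      + \<epsilon> / (6 * (real s + 1)) = \<epsilon> * (6 * real s + 1) / (6 * (real s + 1))"
  proof -
    define t where "t = real s + 1"
    have "t \<noteq> 0" "real s = t - 1"
      unfolding t_def by auto
    then show ?thesis
      unfolding t_def[symmetric] by (simp add: field_simps)
  qed
  also have "\<dots> \<le> \<epsilon>"
    using assms(1) by (simp add: divide_le_eq)
  finally show ?thesis
    using collisions by linarith
qed

theorem lemma4p1:
  fixes s q n :: nat and \<epsilon> :: real and A :: "'a set"
    and \<mu> :: "(nat \<Rightarrow> bool) pmf" and \<xi> :: "((nat \<Rightarrow> bool) \<times> 'a) pmf"
  assumes "0 < \<epsilon>" "\<epsilon> < 1"
    and "is_detailing n \<mu> A \<xi>"
    and "good_detailing n (\<epsilon> / (3 * (real s + 1))) q A \<xi>"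
    and "real n \<ge> 6 * real q ^ 2 * (real s + 1) / \<epsilon>"
  shows "dTV (D_sim s q (weight_dist \<xi>) (type_dist n \<xi>)) (D_test n s q \<mu>) \<le> \<epsilon>"
proof (cases "q = 0")
  case True
  then show ?thesis
    using assms(1) D_sim_no_columns_eq_D_test[of s "weight_dist \<xi>" "type_dist n \<xi>" n \<mu>] by simp
next
  case False
  define e where "e = \<epsilon> / (3 * (real s + 1))"
  have e: "0 \<le> e"
    using assms(1) by (simp add: e_def)
  have "0 < 6 * real q ^ 2 * (real s + 1) / \<epsilon>"
    using False assms(1) by simp
  then have n: "0 < n"
    using assms(5) by simp
  have \<mu>: "\<mu> = map_pmf fst \<xi>"
    using assms(3) by (simp add: is_detailing_def)
  obtain G where G: "1 - e \<le> measure_pmf.prob (weight_dist \<xi>) G"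
    and G_good: "\<And>a. a \<in> G \<Longrightarrow> 0 < pmf (weight_dist \<xi>) a \<and> good_dist n e q (cond_first \<xi> a)"
    using assms(4) unfolding good_detailing_def e_def by blast
  show ?thesis
    using dTV_D_sim_D_test_le[OF e, where n=n and q=q and s=s and \<xi>=\<xi>]
      prob_not_good_sample_le[OF n e G G_good, where s=s]
      error_budget[OF assms(1,5)]
    unfolding \<mu> e_def by linarith
qed

end
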